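(* Consider the R-MESAV-1/CN scheme, as defined in the context, for the gradient flow $\partial_t\phi=-\mathcal G\mu$, $\mu=\mathcal L\phi+F_1'(\phi)+F_2'(\phi)$, with time step $\delta t>0$ and parameter $\gamma\in[0,1]$. At each time step let $(\phi^{n+1},\mu^{n+\frac12},\tilde r_1^{n+1},\tilde r_2^{n+1})$ be the output of Step 1, and set, for $i=1,2$, $$a_i=\tilde r_i^{n+1}-\exp(E_i(\phi^{n+1})),\qquad b_i=\exp(E_i(\phi^{n+1})),$$ $$c=\exp\big(\delta t\,\gamma(\mathcal G\mu^{n+\frac12},\mu^{n+\frac12})+\ln(\tilde r_1^{n+1})+\ln(\tilde r_2^{n+1})\big),$$ and, when $a_1a_2\neq0$, $$\theta_1=\frac{-(a_1b_2+a_2b_1)-\sqrt{(a_1b_2+a_2b_1)^2-4a_1a_2(b_1b_2-c)}}{2a_1a_2}.$$ Choose $\theta_0^{n+1}$ in Step 2 as follows: 1. If $a_1=0$ and $a_2=0$, set $\theta_0^{n+1}=0$. 2. If $a_1>0$ and $a_2>0$, set $\theta_0^{n+1}=0$. 3. If $a_1<0$ and $a_2<0$, set $\theta_0^{n+1}=\max\{0,\theta_1\}$. 4. If $a_1a_2<0$ and $b_1b_2-c\le0$, set $\theta_0^{n+1}=0$. 5. If $a_1a_2<0$ and $b_1b_2-c>0$, set $\theta_0^{n+1}=\theta_1$. 6. If $a_1a_2=0$ and $a_1b_2+a_2b_1>0$, set $\theta_0^{n+1}=0$. 7. If $a_1a_2=0$ and $a_1b_2+a_2b_1<0$, set $\theta_0^{n+1}=\max\Big\{0,\dfrac{c-b_1b_2}{a_1b_2+a_2b_1}\Big\}$.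 Then in all cases $$(a_1\theta_0^{n+1}+b_1)(a_2\theta_0^{n+1}+b_2)\le c$$ and $\theta_0^{n+1}\in\mathcal W$. Moreover $r_1^{n+1}>0$ and $r_2^{n+1}>0$, and the scheme with this choice of $\theta_0^{n+1}$ is unconditionally energy stable (for every $\delta t>0$) in the sense that $$R^{n+1}-R^n\le-\delta t(1-\gamma)(\mathcal G\mu^{n+\frac12},\mu^{n+\frac12})\le0,\qquad R^{n+1}=\tfrac12(\mathcal L\phi^{n+1},\phi^{n+1})+\ln(r_1^{n+1})+\ln(r_2^{n+1}).$$
   Context: Setting. $(\cdot,\cdot)$ is the $L^2(\Omega)$ inner product. $\mathcal L$ is a self-adjoint linear elliptic operator. $\mathcal G$ is a linear positive definite operator, so $(\mathcal G\mu,\mu)\ge0$. $F_1,F_2$ are nonlinear potential functions and $E_i(\phi)=\int_\Omega F_i(\phi)\,d\boldsymbol x$, $i=1,2$. All functions are assumed to lie in spaces (with suitable boundary conditions) where the expressions below make sense. Set, for $i=1,2$, $$U_i(r_i,\phi)=\frac{r_i}{\exp(E_i(\phi))}F_i'(\phi).$$ Notation: $g^{n+\frac12}=\frac12(g^{n+1}+g^n)$ when $g=\phi$; $\mu^{n+\frac12}$ denotes the quantity defined by the scheme; and $g^{*,n+\frac12}$ is any second-order explicit approximation of $g(t^{n+1/2})$ computed from earlier time levels, e.g. $g^{*,n+\frac12}=\frac32g^n-\frac12g^{n-1}$. R-MESAV-1/CN scheme. The values $\phi^{n-1},\phi^n,r_1^{n-1},r_1^n,r_2^{n-1},r_2^n$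 are given, with positive $r_i$-values; $r_i$ discretizes the scalar auxiliary variable $\exp(E_i(\phi(t)))$. Step 1: find $(\phi^{n+1},\mu^{n+\frac12},\tilde r_1^{n+1},\tilde r_2^{n+1})$ satisfying $$\frac{\phi^{n+1}-\phi^n}{\delta t}=-\mathcal G\mu^{n+\frac12},$$ $$\mu^{n+\frac12}=\mathcal L\phi^{n+\frac12}+U_1\big(r_1^{*,n+\frac12},\phi^{*,n+\frac12}\big)+U_2\big(r_2^{*,n+\frac12},\phi^{*,n+\frac12}\big),$$ $$\frac{\ln(\tilde r_i^{n+1})-\ln(r_i^n)}{\delta t}=\Big(U_i\big(r_i^{*,n+\frac12},\phi^{*,n+\frac12}\big),\frac{\phi^{n+1}-\phi^n}{\delta t}\Big),\quad i=1,2.$$ Step 2: set $r_i^{n+1}=\theta_0^{n+1}\tilde r_i^{n+1}+(1-\theta_0^{n+1})\exp(E_i(\phi^{n+1}))$ for $i=1,2$, with $\theta_0^{n+1}\in\mathcal W$. Here $\mathcal W$ is the set of $\theta\in[0,1]$ such that $r_{i,\theta}:=\theta\tilde r_i^{n+1}+(1-\theta)\exp(E_i(\phi^{n+1}))$ satisfy $$\ln(r_{1,\theta})+\ln(r_{2,\theta})-\ln(\tilde r_1^{n+1})-\ln(\tilde r_2^{n+1})\le\delta t\,\gamma\,(\mathcal G\mu^{n+\frac12},\mu^{n+\frac12}),$$ where $\gamma\in[0,1]$ is a fixed adjustable parameter. *)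

theory Defs
  imports "HOL-Analysis.Analysis"
begin

text \<open>Functions on \<open>\<Omega>\<close> are represented by total functions on the ambient Euclidean space. Only
  their values on \<open>\<Omega>\<close> enter, and equations between them are understood almost everywhere.\<close>

definition L2_space :: "'a::euclidean_space set \<Rightarrow> ('a \<Rightarrow> real) set" where
  "L2_space \<Omega> = {f \<in> borel_measurable (lebesgue_on \<Omega>). integrable (lebesgue_on \<Omega>) (\<lambda>x. (f x)\<^sup>2)}"

definition l2_inner :: "'a::euclidean_space set \<Rightarrow> ('a \<Rightarrow> real) \<Rightarrow> ('a \<Rightarrow> real) \<Rightarrow> real" where
  "l2_inner \<Omega> f g = (LINT x|lebesgue_on \<Omega>. f x * g x)"

text \<open>A (possibly unbounded) linear operator on \<open>L\<^sup>2(\<Omega>)\<close> with domain \<open>D\<close>; boundary conditions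
  are encoded in the choice of \<open>D\<close>.\<close>

definition linear_operator_on ::
  "'a::euclidean_space set \<Rightarrow> ('a \<Rightarrow> real) set \<Rightarrow> (('a \<Rightarrow> real) \<Rightarrow> 'a \<Rightarrow> real) \<Rightarrow> bool" where
  "linear_operator_on \<Omega> D T \<longleftrightarrow>
     D \<subseteq> L2_space \<Omega> \<and> (\<lambda>x. 0) \<in> D \<and>
     (\<forall>u\<in>D. \<forall>v\<in>D. \<forall>s t. (\<lambda>x. s * u x + t * v x) \<in> D) \<and>
     (\<forall>u\<in>D. T u \<in> L2_space \<Omega>) \<and>
     (\<forall>u\<in>D. \<forall>v\<in>D. \<forall>s t.
        AE x in lebesgue_on \<Omega>. T (\<lambda>x. s * u x + t * v x) x = s * T u x + t * T v x)"

definition self_adjoint_on ::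
  "'a::euclidean_space set \<Rightarrow> ('a \<Rightarrow> real) set \<Rightarrow> (('a \<Rightarrow> real) \<Rightarrow> 'a \<Rightarrow> real) \<Rightarrow> bool" where
  "self_adjoint_on \<Omega> D T \<longleftrightarrow> (\<forall>u\<in>D. \<forall>v\<in>D. l2_inner \<Omega> (T u) v = l2_inner \<Omega> u (T v))"

text \<open>Positivity is taken in the sense \<open>(T u, u) \<ge> 0\<close>, so that operators with a kernel, such as
  \<open>-\<Delta>\<close> with periodic or Neumann conditions, are covered.\<close>

definition positive_on ::
  "'a::euclidean_space set \<Rightarrow> ('a \<Rightarrow> real) set \<Rightarrow> (('a \<Rightarrow> real) \<Rightarrow> 'a \<Rightarrow> real) \<Rightarrow> bool" where
  "positive_on \<Omega> D T \<longleftrightarrow> (\<forall>u\<in>D. l2_inner \<Omega> (T u) u \<ge> 0)"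

text \<open>Operators of the gradient flow \<open>\<partial>\<^sub>t \<phi> = - G \<mu>\<close>, \<open>\<mu> = L \<phi> + F\<^sub>1'(\<phi>) + F\<^sub>2'(\<phi>)\<close>. No ellipticity
  is imposed on \<open>L\<close>: every self-adjoint linear operator, elliptic or not, is admitted.\<close>

definition gradient_flow_operators ::
  "'a::euclidean_space set \<Rightarrow> ('a \<Rightarrow> real) set \<Rightarrow> (('a \<Rightarrow> real) \<Rightarrow> 'a \<Rightarrow> real) \<Rightarrow>
   ('a \<Rightarrow> real) set \<Rightarrow> (('a \<Rightarrow> real) \<Rightarrow> 'a \<Rightarrow> real) \<Rightarrow> bool" where
  "gradient_flow_operators \<Omega> DL L DG G \<longleftrightarrow>
     \<Omega> \<in> sets lebesgue \<and>
     linear_operator_on \<Omega> DL L \<and> self_adjoint_on \<Omega> DL L \<and>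
     linear_operator_on \<Omega> DG G \<and> positive_on \<Omega> DG G"

definition energy :: "'a::euclidean_space set \<Rightarrow> (real \<Rightarrow> real) \<Rightarrow> ('a \<Rightarrow> real) \<Rightarrow> real" where
  "energy \<Omega> F \<phi> = (LINT x|lebesgue_on \<Omega>. F (\<phi> x))"

definition energy_defined :: "'a::euclidean_space set \<Rightarrow> (real \<Rightarrow> real) \<Rightarrow> ('a \<Rightarrow> real) \<Rightarrow> bool" where
  "energy_defined \<Omega> F \<phi> \<longleftrightarrow> integrable (lebesgue_on \<Omega>) (\<lambda>x. F (\<phi> x))"

definition U_term ::
  "'a::euclidean_space set \<Rightarrow> (real \<Rightarrow> real) \<Rightarrow> real \<Rightarrow> ('a \<Rightarrow> real) \<Rightarrow> 'a \<Rightarrow> real" where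
  "U_term \<Omega> F r \<phi> = (\<lambda>x. r / exp (energy \<Omega> F \<phi>) * deriv F (\<phi> x))"

text \<open>Differentiability of \<open>F\<close> is required only at the values actually taken, so that singular
  potentials (for example logarithmic ones) are covered.\<close>

definition U_defined :: "'a::euclidean_space set \<Rightarrow> (real \<Rightarrow> real) \<Rightarrow> ('a \<Rightarrow> real) \<Rightarrow> bool" where
  "U_defined \<Omega> F \<phi> \<longleftrightarrow>
     energy_defined \<Omega> F \<phi> \<and>
     (AE x in lebesgue_on \<Omega>. F differentiable (at (\<phi> x))) \<and>
     (\<lambda>x. deriv F (\<phi> x)) \<in> L2_space \<Omega>"

text \<open>Step 1 of the R-MESAV-1/CN scheme from time level \<open>n\<close> to \<open>n + 1\<close>. Here \<open>\<mu> n\<close> stands for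
  \<open>\<mu>\<^bsup>n+1/2\<^esup>\<close>, \<open>\<phi>s n\<close> and \<open>rs i n\<close> for the explicit approximations at \<open>t\<^bsup>n+1/2\<^esup>\<close> (left arbitrary,
  so that every extrapolation formula is admitted), and \<open>rt i (Suc n)\<close> for the unrelaxed value of the
  \<open>i\<close>-th auxiliary variable. The condition \<open>rt i (Suc n) > 0\<close> is the one under which its logarithm
  is meaningful; \<^const>\<open>ln\<close> is total.\<close>

definition step1 ::
  "'a::euclidean_space set \<Rightarrow> ('a \<Rightarrow> real) set \<Rightarrow> (('a \<Rightarrow> real) \<Rightarrow> 'a \<Rightarrow> real) \<Rightarrow>
   ('a \<Rightarrow> real) set \<Rightarrow> (('a \<Rightarrow> real) \<Rightarrow> 'a \<Rightarrow> real) \<Rightarrow> (nat \<Rightarrow> real \<Rightarrow> real) \<Rightarrow> real \<Rightarrow>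
   (nat \<Rightarrow> 'a \<Rightarrow> real) \<Rightarrow> (nat \<Rightarrow> 'a \<Rightarrow> real) \<Rightarrow> (nat \<Rightarrow> 'a \<Rightarrow> real) \<Rightarrow>
   (nat \<Rightarrow> nat \<Rightarrow> real) \<Rightarrow> (nat \<Rightarrow> nat \<Rightarrow> real) \<Rightarrow> (nat \<Rightarrow> nat \<Rightarrow> real) \<Rightarrow> nat \<Rightarrow> bool" where
  "step1 \<Omega> DL L DG G F \<delta>t \<phi> \<phi>s \<mu> r rs rt n \<longleftrightarrow>
     \<phi> n \<in> DL \<and> \<phi> (Suc n) \<in> DL \<and> \<mu> n \<in> DG \<and>
     (\<forall>i\<in>{1, 2}. energy_defined \<Omega> (F i) (\<phi> (Suc n)) \<and> U_defined \<Omega> (F i) (\<phi>s n)) \<and>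
     (AE x in lebesgue_on \<Omega>. (\<phi> (Suc n) x - \<phi> n x) / \<delta>t = - G (\<mu> n) x) \<and>
     (AE x in lebesgue_on \<Omega>. \<mu> n x =
        L (\<lambda>y. 1 / 2 * (\<phi> (Suc n) y + \<phi> n y)) x
        + U_term \<Omega> (F 1) (rs 1 n) (\<phi>s n) x + U_term \<Omega> (F 2) (rs 2 n) (\<phi>s n) x) \<and>
     (\<forall>i\<in>{1, 2}. rt i (Suc n) > 0 \<and>
        (ln (rt i (Suc n)) - ln (r i n)) / \<delta>t =
          l2_inner \<Omega> (U_term \<Omega> (F i) (rs i n) (\<phi>s n)) (\<lambda>x. (\<phi> (Suc n) x - \<phi> n x) / \<delta>t))"

text \<open>The set \<open>W\<close>, with \<open>b i\<close> in the role of \<open>exp (E\<^sub>i(\<phi>\<^bsup>n+1\<^esup>))\<close>, \<open>t i\<close> of the unrelaxed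
  auxiliary variable, and \<open>d\<close> of \<open>(G \<mu>\<^bsup>n+1/2\<^esup>, \<mu>\<^bsup>n+1/2\<^esup>)\<close>.\<close>

definition relaxation_set :: "real \<Rightarrow> real \<Rightarrow> real \<Rightarrow> (nat \<Rightarrow> real) \<Rightarrow> (nat \<Rightarrow> real) \<Rightarrow> real set" where
  "relaxation_set \<delta>t \<gamma> d t b =
     {\<theta> \<in> {0..1}. ln (\<theta> * t 1 + (1 - \<theta>) * b 1) + ln (\<theta> * t 2 + (1 - \<theta>) * b 2)
                    - ln (t 1) - ln (t 2) \<le> \<delta>t * \<gamma> * d}"

definition theta1 :: "real \<Rightarrow> real \<Rightarrow> real \<Rightarrow> real \<Rightarrow> real \<Rightarrow> real" where
  "theta1 a1 a2 b1 b2 c =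
     (- (a1 * b2 + a2 * b1) - sqrt ((a1 * b2 + a2 * b1)\<^sup>2 - 4 * a1 * a2 * (b1 * b2 - c)))
       / (2 * a1 * a2)"

definition theta_choice :: "real \<Rightarrow> real \<Rightarrow> real \<Rightarrow> real \<Rightarrow> real \<Rightarrow> real \<Rightarrow> bool" where
  "theta_choice a1 a2 b1 b2 c \<theta> \<longleftrightarrow>
     (a1 = 0 \<and> a2 = 0 \<longrightarrow> \<theta> = 0) \<and>
     (a1 > 0 \<and> a2 > 0 \<longrightarrow> \<theta> = 0) \<and>
     (a1 < 0 \<and> a2 < 0 \<longrightarrow> \<theta> = max 0 (theta1 a1 a2 b1 b2 c)) \<and>
     (a1 * a2 < 0 \<and> b1 * b2 - c \<le> 0 \<longrightarrow> \<theta> = 0) \<and>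
     (a1 * a2 < 0 \<and> b1 * b2 - c > 0 \<longrightarrow> \<theta> = theta1 a1 a2 b1 b2 c) \<and>
     (a1 * a2 = 0 \<and> a1 * b2 + a2 * b1 > 0 \<longrightarrow> \<theta> = 0) \<and>
     (a1 * a2 = 0 \<and> a1 * b2 + a2 * b1 < 0 \<longrightarrow>
        \<theta> = max 0 ((c - b1 * b2) / (a1 * b2 + a2 * b1)))"

end

theory Submission
  imports Defs "HOL-Library.Quadratic_Discriminant"
begin

text \<open>Testing the equation for \<open>\<mu>\<^bsup>n+1/2\<^esup>\<close> with \<open>\<phi>\<^bsup>n+1\<^esup> - \<phi>\<^bsup>n\<^esup>\<close> makes the nonlinear terms telescope
  into the differences of the logarithms of the auxiliary variables, which gives the energy law with
  the unrelaxed variables. Relaxation costs at most \<open>\<gamma>\<close> times the dissipation exactly when the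
  quadratic polynomial \<open>(a\<^sub>1 \<theta> + b\<^sub>1) (a\<^sub>2 \<theta> + b\<^sub>2) - c\<close> is nonpositive. Since it is nonpositive at
  \<open>\<theta> = 1\<close>, its discriminant and the position of its roots relative to \<open>[0, 1]\<close> are under control,
  and in each case the prescribed \<open>\<theta>\<close> is either \<open>0\<close> or a root in \<open>[0, 1]\<close>.\<close>

section \<open>Bilinearity of the inner product\<close>

lemma L2_space_measurable:
  "f \<in> L2_space \<Omega> \<Longrightarrow> f \<in> borel_measurable (lebesgue_on \<Omega>)"
  by (simp add: L2_space_def)

text \<open>Domination by \<open>f^2 + g^2\<close>, from \<open>2|u||v| \<le> u^2 + v^2\<close>.
  This integrability is what permits splitting an inner product over a sum.\<close>

lemma L2_space_integrable_mult:
  assumes "f \<in> L2_space \<Omega>" "g \<in> L2_space \<Omega>"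
  shows "integrable (lebesgue_on \<Omega>) (\<lambda>x. f x * g x)"
proof (rule Bochner_Integration.integrable_bound)
  show "integrable (lebesgue_on \<Omega>) (\<lambda>x. (f x)\<^sup>2 + (g x)\<^sup>2)"
    using assms by (simp add: L2_space_def)
  show "(\<lambda>x. f x * g x) \<in> borel_measurable (lebesgue_on \<Omega>)"
    by (rule borel_measurable_times[OF assms[THEN L2_space_measurable]])
  have "\<bar>u * v\<bar> \<le> u\<^sup>2 + v\<^sup>2" for u v :: real
    using sum_squares_bound[of "\<bar>u\<bar>" "\<bar>v\<bar>"] mult_nonneg_nonneg[of "\<bar>u\<bar>" "\<bar>v\<bar>"]
    unfolding abs_mult power2_abs by linarith
  then show "AE x in lebesgue_on \<Omega>. norm (f x * g x) \<le> norm ((f x)\<^sup>2 + (g x)\<^sup>2)"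
    by simp
qed

lemma L2_space_lincomb:
  assumes f: "f \<in> L2_space \<Omega>" and g: "g \<in> L2_space \<Omega>"
  shows "(\<lambda>x. s * f x + t * g x) \<in> L2_space \<Omega>"
proof -
  have "integrable (lebesgue_on \<Omega>)
          (\<lambda>x. s\<^sup>2 * (f x * f x) + 2 * s * t * (f x * g x) + t\<^sup>2 * (g x * g x))"
    by (intro Bochner_Integration.integrable_add integrable_mult_right L2_space_integrable_mult f g)
  also have "(\<lambda>x. s\<^sup>2 * (f x * f x) + 2 * s * t * (f x * g x) + t\<^sup>2 * (g x * g x))
             = (\<lambda>x. (s * f x + t * g x)\<^sup>2)"
    by (rule ext) (simp add: power2_eq_square algebra_simps)
  finally show ?thesis
    using L2_space_measurable[OF f] L2_space_measurable[OF g] by (simp add: L2_space_def)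
qed

lemma L2_space_scale: "f \<in> L2_space \<Omega> \<Longrightarrow> (\<lambda>x. s * f x) \<in> L2_space \<Omega>"
  using L2_space_lincomb[of f \<Omega> f s 0] by simp

lemma l2_inner_commute: "l2_inner \<Omega> f g = l2_inner \<Omega> g f"
  by (simp add: l2_inner_def mult.commute)

lemma l2_inner_lincomb_left:
  assumes "f \<in> L2_space \<Omega>" "g \<in> L2_space \<Omega>" "h \<in> L2_space \<Omega>"
  shows "l2_inner \<Omega> (\<lambda>x. s * f x + t * g x) h = s * l2_inner \<Omega> f h + t * l2_inner \<Omega> g h"
proof -
  have "l2_inner \<Omega> (\<lambda>x. s * f x + t * g x) h
        = (LINT x|lebesgue_on \<Omega>. s * (f x * h x) + t * (g x * h x))"
    by (simp add: l2_inner_def algebra_simps)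
  also have "\<dots> = s * l2_inner \<Omega> f h + t * l2_inner \<Omega> g h"
    using assms by (subst Bochner_Integration.integral_add)
      (auto simp: l2_inner_def intro!: L2_space_integrable_mult integrable_mult_right)
  finally show ?thesis .
qed

lemma l2_inner_lincomb_right:
  assumes "f \<in> L2_space \<Omega>" "g \<in> L2_space \<Omega>" "h \<in> L2_space \<Omega>"
  shows "l2_inner \<Omega> h (\<lambda>x. s * f x + t * g x) = s * l2_inner \<Omega> h f + t * l2_inner \<Omega> h g"
  using l2_inner_lincomb_left[OF assms] by (simp add: l2_inner_commute)

text \<open>Free of integrability hypotheses: a scalar factor leaves the integral even where the
  integral takes its default value 0.\<close>

lemma l2_inner_scale_right: "l2_inner \<Omega> f (\<lambda>x. s * g x) = s * l2_inner \<Omega> f g"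
proof -
  have "l2_inner \<Omega> f (\<lambda>x. s * g x) = (LINT x|lebesgue_on \<Omega>. s * (f x * g x))"
    unfolding l2_inner_def by (simp only: mult.left_commute)
  then show ?thesis
    by (simp add: l2_inner_def)
qed

text \<open>The equations of the scheme and the linearity of the operators hold only almost
  everywhere; this carries them into inner products.\<close>

lemma l2_inner_cong_AE:
  assumes "f \<in> L2_space \<Omega>" "f' \<in> L2_space \<Omega>" "g \<in> L2_space \<Omega>"
    and "AE x in lebesgue_on \<Omega>. f x = f' x"
  shows "l2_inner \<Omega> f g = l2_inner \<Omega> f' g"
  unfolding l2_inner_def
proof (rule integral_cong_AE)
  show "AE x in lebesgue_on \<Omega>. f x * g x = f' x * g x"
    using assms(4) by eventually_elim simp
qed (rule borel_measurable_times[OF assms(1,3)[THEN L2_space_measurable]]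
    borel_measurable_times[OF assms(2,3)[THEN L2_space_measurable]])+

lemma U_term_in_L2_space:
  assumes "U_defined \<Omega> F \<phi>"
  shows "U_term \<Omega> F s \<phi> \<in> L2_space \<Omega>"
  using assms unfolding U_term_def U_defined_def by (intro L2_space_scale) simp

lemma linear_operator_onD:
  assumes "linear_operator_on \<Omega> D T"
  shows "u \<in> D \<Longrightarrow> u \<in> L2_space \<Omega>"
    and "u \<in> D \<Longrightarrow> T u \<in> L2_space \<Omega>"
    and "u \<in> D \<Longrightarrow> v \<in> D \<Longrightarrow> (\<lambda>x. s * u x + t * v x) \<in> D"
    and "u \<in> D \<Longrightarrow> v \<in> D \<Longrightarrow>
      AE x in lebesgue_on \<Omega>. T (\<lambda>x. s * u x + t * v x) x = s * T u x + t * T v x"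
  using assms unfolding linear_operator_on_def by blast+

section \<open>The discrete energy law\<close>

text \<open>Self-adjointness cancels the cross terms, as in (v + u)(v - u)/2, so the midpoint rule
  reproduces the quadratic energy difference exactly.\<close>

lemma self_adjoint_midpoint_difference:
  assumes lin: "linear_operator_on \<Omega> D T" and sa: "self_adjoint_on \<Omega> D T"
    and u: "u \<in> D" and v: "v \<in> D"
  shows "l2_inner \<Omega> (T (\<lambda>x. 1 / 2 * (v x + u x))) (\<lambda>x. v x - u x)
         = 1 / 2 * l2_inner \<Omega> (T v) v - 1 / 2 * l2_inner \<Omega> (T u) u"
proof -
  note [simp] = linear_operator_onD(1,2)[OF lin] u v L2_space_lincomb
  have mid: "(\<lambda>x. 1 / 2 * (v x + u x)) = (\<lambda>x. 1 / 2 * v x + 1 / 2 * u x)"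
    and diff: "(\<lambda>x. v x - u x) = (\<lambda>x. 1 * v x + (-1) * u x)"
    by (auto simp: algebra_simps)
  have "l2_inner \<Omega> (T (\<lambda>x. 1 / 2 * v x + 1 / 2 * u x)) (\<lambda>x. 1 * v x + (-1) * u x)
        = l2_inner \<Omega> (\<lambda>x. 1 / 2 * T v x + 1 / 2 * T u x) (\<lambda>x. 1 * v x + (-1) * u x)"
    by (intro l2_inner_cong_AE linear_operator_onD(2-4)[OF lin] L2_space_lincomb
        linear_operator_onD(1)[OF lin] u v)
  also have "\<dots> = 1 / 2 * (l2_inner \<Omega> (T v) v - l2_inner \<Omega> (T v) u)
                 + 1 / 2 * (l2_inner \<Omega> (T u) v - l2_inner \<Omega> (T u) u)"
    by (subst l2_inner_lincomb_left,
        simp_all only: linear_operator_onD(1,2)[OF lin] u v L2_space_lincomb)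
      (subst (1 2) l2_inner_lincomb_right, simp_all)
  also have "l2_inner \<Omega> (T u) v = l2_inner \<Omega> (T v) u"
    using sa u v by (simp add: self_adjoint_on_def l2_inner_commute[of \<Omega> u])
  finally show ?thesis
    unfolding mid diff by (simp add: field_simps)
qed

text \<open>The pairing of \<open>\<mu> n\<close> with the increment of \<open>\<phi>\<close> is
  evaluated twice: through the flow equation (\<open>dissipation\<close>) and through the equation
  for \<open>\<mu> n\<close>. No term is estimated, hence an equality.\<close>

lemma step1_energy_law:
  assumes ops: "gradient_flow_operators \<Omega> DL L DG G" and dt: "\<delta>t > 0"
    and step: "step1 \<Omega> DL L DG G F \<delta>t \<phi> \<phi>s \<mu> r rs rt n"
  shows "1 / 2 * l2_inner \<Omega> (L (\<phi> (Suc n))) (\<phi> (Suc n)) + ln (rt 1 (Suc n)) + ln (rt 2 (Suc n))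
         - (1 / 2 * l2_inner \<Omega> (L (\<phi> n)) (\<phi> n) + ln (r 1 n) + ln (r 2 n))
         = - \<delta>t * l2_inner \<Omega> (G (\<mu> n)) (\<mu> n)"
proof -
  let ?u = "\<phi> n" and ?v = "\<phi> (Suc n)"
  let ?mid = "\<lambda>y. 1 / 2 * (?v y + ?u y)"
  let ?diff = "\<lambda>x. ?v x - ?u x"
  let ?U = "\<lambda>i. U_term \<Omega> (F i) (rs i n) (\<phi>s n)"
  have linL: "linear_operator_on \<Omega> DL L" and saL: "self_adjoint_on \<Omega> DL L"
    and linG: "linear_operator_on \<Omega> DG G"
    using ops by (auto simp: gradient_flow_operators_def)
  have dom: "?u \<in> DL" "?v \<in> DL" "\<mu> n \<in> DG"
    and U_def: "U_defined \<Omega> (F 1) (\<phi>s n)" "U_defined \<Omega> (F 2) (\<phi>s n)"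
    and flow: "AE x in lebesgue_on \<Omega>. (?v x - ?u x) / \<delta>t = - G (\<mu> n) x"
    and chem: "AE x in lebesgue_on \<Omega>. \<mu> n x = L ?mid x + ?U 1 x + ?U 2 x"
    and aux: "\<And>i. i \<in> {1, 2} \<Longrightarrow>
      (ln (rt i (Suc n)) - ln (r i n)) / \<delta>t = l2_inner \<Omega> (?U i) (\<lambda>x. (?v x - ?u x) / \<delta>t)"
    using step unfolding step1_def by blast+
  have mid: "?mid \<in> DL"
    using linear_operator_onD(3)[OF linL dom(2) dom(1), of "1/2" "1/2"] by (simp add: algebra_simps)
  have diff: "?diff \<in> DL"
    using linear_operator_onD(3)[OF linL dom(2) dom(1), of 1 "-1"] by simp
  have L2: "L ?mid \<in> L2_space \<Omega>" "?diff \<in> L2_space \<Omega>" "\<mu> n \<in> L2_space \<Omega>" "G (\<mu> n) \<in> L2_space \<Omega>"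
    "?U 1 \<in> L2_space \<Omega>" "?U 2 \<in> L2_space \<Omega>"
    using linear_operator_onD(1,2)[OF linL] linear_operator_onD(1,2)[OF linG] mid diff dom U_def
    by (auto intro: U_term_in_L2_space)
  have U12: "(\<lambda>x. 1 * ?U 1 x + 1 * ?U 2 x) \<in> L2_space \<Omega>"
    by (intro L2_space_lincomb L2)
  have log: "ln (rt i (Suc n)) - ln (r i n) = l2_inner \<Omega> (?U i) ?diff" if "i \<in> {1, 2}" for i
    using aux[OF that] l2_inner_scale_right[of \<Omega> "?U i" "1 / \<delta>t" ?diff] dt
    by (simp add: divide_simps)
  have "l2_inner \<Omega> ?diff (\<mu> n) = l2_inner \<Omega> (\<lambda>x. (- \<delta>t) * G (\<mu> n) x) (\<mu> n)"
  proof (rule l2_inner_cong_AE)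
    show "AE x in lebesgue_on \<Omega>. ?diff x = (- \<delta>t) * G (\<mu> n) x"
      using flow by eventually_elim (use dt in \<open>simp add: field_simps\<close>)
  qed (intro L2 L2_space_scale)+
  also have "\<dots> = - \<delta>t * l2_inner \<Omega> (G (\<mu> n)) (\<mu> n)"
    using l2_inner_scale_right[of \<Omega> "\<mu> n" "- \<delta>t" "G (\<mu> n)"] by (simp only: l2_inner_commute)
  finally have dissipation: "l2_inner \<Omega> (\<mu> n) ?diff = - \<delta>t * l2_inner \<Omega> (G (\<mu> n)) (\<mu> n)"
    by (simp only: l2_inner_commute)
  \<comment> \<open>The second evaluation. Unit coefficients and nesting let the two-term linearity
    rule split three summands.\<close>
  have "l2_inner \<Omega> (\<mu> n) ?diff
        = l2_inner \<Omega> (\<lambda>x. 1 * L ?mid x + 1 * (1 * ?U 1 x + 1 * ?U 2 x)) ?diff"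
  proof (rule l2_inner_cong_AE)
    show "AE x in lebesgue_on \<Omega>. \<mu> n x = 1 * L ?mid x + 1 * (1 * ?U 1 x + 1 * ?U 2 x)"
      using chem by eventually_elim simp
    show "(\<lambda>x. 1 * L ?mid x + 1 * (1 * ?U 1 x + 1 * ?U 2 x)) \<in> L2_space \<Omega>"
      by (rule L2_space_lincomb[OF L2(1) U12])
  qed (rule L2)+
  also have "\<dots> = l2_inner \<Omega> (L ?mid) ?diff + l2_inner \<Omega> (?U 1) ?diff + l2_inner \<Omega> (?U 2) ?diff"
    unfolding l2_inner_lincomb_left[OF L2(1) U12 L2(2)] l2_inner_lincomb_left[OF L2(5,6,2)] by simp
  also have "\<dots> = 1 / 2 * l2_inner \<Omega> (L ?v) ?v - 1 / 2 * l2_inner \<Omega> (L ?u) ?u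
                 + (ln (rt 1 (Suc n)) - ln (r 1 n)) + (ln (rt 2 (Suc n)) - ln (r 2 n))"
    unfolding self_adjoint_midpoint_difference[OF linL saL dom(1,2)] using log[of 1] log[of 2] by simp
  finally show ?thesis
    unfolding dissipation by simp
qed

section \<open>The choice of the relaxation parameter\<close>

text \<open>Completing the square: \<open>(2 * A * x + B)^2\<close> exceeds the discriminant by
  \<open>4 * A\<close> times the value at \<open>x\<close>.\<close>

lemma quadratic_nonpos_discrim:
  fixes A B C x :: real
  assumes "A * x\<^sup>2 + B * x + C \<le> 0" "A > 0"
  shows "B\<^sup>2 - 4 * A * C \<ge> (2 * A * x + B)\<^sup>2"
proof -
  have "(2 * A * x + B)\<^sup>2 = 4 * A * (A * x\<^sup>2 + B * x + C) + (B\<^sup>2 - 4 * A * C)"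
    by (simp add: power2_eq_square algebra_simps)
  moreover have "4 * A * (A * x\<^sup>2 + B * x + C) \<le> 0"
    using assms by (simp add: mult_nonneg_nonpos)
  ultimately show ?thesis by linarith
qed

text \<open>The minus sign gives the smaller root for \<open>A > 0\<close> and the larger one for
  \<open>A < 0\<close>, so the single formula \<open>theta1\<close> suits both sign
  patterns.\<close>

lemma quadratic_root:
  fixes A B C :: real
  assumes "A \<noteq> 0" "B\<^sup>2 - 4 * A * C \<ge> 0"
  defines "x \<equiv> (- B - sqrt (B\<^sup>2 - 4 * A * C)) / (2 * A)"
  shows "A * x\<^sup>2 + B * x + C = 0"
  using discriminant_iff[OF assms(1), of x B C] assms(2) by (simp add: discrim_def x_def)

text \<open>By \<open>one\<close>, the point 1 lies between the two roots, so the smaller root is at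
  most 1. If that root is negative, 0 lies between the roots as well.\<close>

lemma convex_quadratic_small_root:
  fixes A B C :: real
  assumes A: "A > 0" and one: "A + B + C \<le> 0"
  defines "x \<equiv> (- B - sqrt (B\<^sup>2 - 4 * A * C)) / (2 * A)"
  shows "x \<le> 1" and "A * (max 0 x)\<^sup>2 + B * max 0 x + C \<le> 0"
proof -
  let ?s = "sqrt (B\<^sup>2 - 4 * A * C)"
  have discrim: "(2 * A + B)\<^sup>2 \<le> B\<^sup>2 - 4 * A * C"
    using quadratic_nonpos_discrim[of A 1 B C] A one by simp
  then have s: "\<bar>2 * A + B\<bar> \<le> ?s"
    by (rule real_le_rsqrt[of "\<bar>_\<bar>", simplified])
  then show "x \<le> 1"
    using A by (simp add: x_def divide_simps)
  have root: "A * x\<^sup>2 + B * x + C = 0"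
    unfolding x_def using A order_trans[OF zero_le_power2 discrim] by (intro quadratic_root) simp_all
  show "A * (max 0 x)\<^sup>2 + B * max 0 x + C \<le> 0"
  proof (cases "x \<ge> 0")
    case False
    \<comment> \<open>Convexity made explicit: for the quadratic p, (1 - x) p(0) = p(x) - x p(1) + A
      x (1 - x), and for x < 0 no term on the right is positive.\<close>
    have "C * (1 - x) = (1 - x) * (A * x) - x * (A + B + C) + (A * x\<^sup>2 + B * x + C)"
      by (simp add: power2_eq_square algebra_simps)
    moreover have "(1 - x) * (A * x) \<le> 0"
      using A False by (simp add: mult_nonneg_nonpos)
    moreover have "x * (A + B + C) \<ge> 0"
      using False one by (simp add: mult_nonpos_nonpos)
    ultimately have "C * (1 - x) \<le> 0" using root by simp
    then show ?thesis using False by (simp add: mult_le_0_iff)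
  qed (use root in simp)
qed

text \<open>The value is positive at 0 and nonpositive at 1, and the roots have opposite signs since
  \<open>A * C < 0\<close>; the larger root therefore lies in [0, 1].\<close>

lemma concave_quadratic_large_root:
  fixes A B C :: real
  assumes A: "A < 0" and C: "C > 0" and one: "A + B + C \<le> 0"
  defines "x \<equiv> (- B - sqrt (B\<^sup>2 - 4 * A * C)) / (2 * A)"
  shows "0 \<le> x" and "x \<le> 1" and "A * x\<^sup>2 + B * x + C = 0"
proof -
  let ?s = "sqrt (B\<^sup>2 - 4 * A * C)"
  have AC: "A * C < 0"
    using A C by (simp add: mult_neg_pos)
  have "\<bar>B\<bar> \<le> ?s"
    using AC by (intro real_le_rsqrt) simp
  then show "0 \<le> x"
    using A by (simp add: x_def zero_le_divide_iff)
  show root: "A * x\<^sup>2 + B * x + C = 0"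
    unfolding x_def using A AC by (intro quadratic_root) (auto intro: order_trans[OF _ zero_le_power2])
  \<comment> \<open>Four times this product is \<open>(2 * A + B)^2\<close> minus the discriminant,
    which bounds the square root from above.\<close>
  have "A * (A + B + C) \<ge> 0"
    using A one by (simp add: mult_nonpos_nonpos)
  then have "B\<^sup>2 - 4 * A * C \<le> (2 * A + B)\<^sup>2"
    by (simp add: power2_eq_square algebra_simps)
  moreover have "2 * A + B \<le> 0"
    using A C one by simp
  ultimately have "?s \<le> - (2 * A + B)"
    by (intro real_le_lsqrt) (auto simp: power2_commute power2_eq_square algebra_simps)
  then show "x \<le> 1"
    using A by (simp add: x_def divide_simps)
qed

text \<open>Hypothesis \<open>c\<close> says that the quadratic is nonpositive at 1. Positivity of
  \<open>b1\<close> and \<open>b2\<close> controls the sign of the linear coefficient.\<close>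

lemma theta_choice_admissible:
  fixes a1 a2 b1 b2 c \<theta> :: real
  assumes choice: "theta_choice a1 a2 b1 b2 c \<theta>"
    and b: "b1 > 0" "b2 > 0"
    and c: "(a1 + b1) * (a2 + b2) \<le> c"
  shows "\<theta> \<in> {0..1}" and "(a1 * \<theta> + b1) * (a2 * \<theta> + b2) \<le> c"
proof -
  define A B C where "A = a1 * a2" and "B = a1 * b2 + a2 * b1" and "C = b1 * b2 - c"
  have one: "A + B + C \<le> 0"
    using c by (simp add: A_def B_def C_def algebra_simps)
  have poly: "(a1 * \<theta> + b1) * (a2 * \<theta> + b2) - c = A * \<theta>\<^sup>2 + B * \<theta> + C"
    by (simp add: A_def B_def C_def power2_eq_square algebra_simps)
  have th1: "theta1 a1 a2 b1 b2 c = (- B - sqrt (B\<^sup>2 - 4 * A * C)) / (2 * A)"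
    by (simp add: theta1_def A_def B_def C_def mult.assoc)
  have zero: "\<theta> \<in> {0..1} \<and> A * \<theta>\<^sup>2 + B * \<theta> + C \<le> 0" if "\<theta> = 0" "C \<le> 0"
    using that by simp
  note ch = choice[unfolded theta_choice_def th1, folded A_def B_def C_def]
  have "\<theta> \<in> {0..1} \<and> A * \<theta>\<^sup>2 + B * \<theta> + C \<le> 0"
  proof -
    \<comment> \<open>Sorted by the sign of the leading coefficient; \<open>A > 0\<close> means that
      \<open>a1\<close> and \<open>a2\<close> share a sign.\<close>
    consider "A < 0" "C \<le> 0" | "A < 0" "C > 0" | "A = 0" "B \<ge> 0" | "A = 0" "B < 0"
      | "a1 > 0" "a2 > 0" | "a1 < 0" "a2 < 0"
      unfolding A_def by (smt (verit) mult_neg_pos mult_pos_neg mult_eq_0_iff)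
    then show ?thesis
    proof cases
      case 1
      then show ?thesis using ch zero by simp
    next
      case 2
      then show ?thesis using ch concave_quadratic_large_root[OF 2 one] by simp
    next
      case 3
      \<comment> \<open>Closes the gap between the rules for \<open>A = 0\<close>: a vanishing
        \<open>B\<close> leaves only the first rule, which also sets \<open>\<theta>\<close> to
        0.\<close>
      have "a1 = 0 \<and> a2 = 0" if "B = 0"
        using that 3(1) b by (auto simp: A_def B_def)
      then have "\<theta> = 0"
        using 3 ch by (cases "B = 0") simp_all
      then show ?thesis using 3 one zero by simp
    next
      case 4
      then have \<theta>: "\<theta> = max 0 ((- C) / B)"
        using ch by (simp add: C_def)
      \<comment> \<open>The polynomial is affine and decreasing with root \<open>- C / B\<close>;
        being nonpositive at 1, it has its root at or before 1.\<close>
      have "- C / B \<le> 1"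
        using 4 one by (simp add: divide_simps)
      moreover have "B * max 0 (- C / B) + C \<le> 0"
        using 4 by (auto simp: max_def divide_simps)
      ultimately show ?thesis using 4 \<theta> by simp
    next
      case 5
      \<comment> \<open>The quadratic then increases on [0, 1], so nonpositivity at 1 passes to
        0.\<close>
      then have "A > 0" "B > 0"
        using b by (simp_all add: A_def B_def add_pos_pos)
      then show ?thesis using 5 ch one zero by simp
    next
      case 6
      then have "A > 0" by (simp add: A_def mult_neg_neg)
      then show ?thesis
        using 6 ch convex_quadratic_small_root[OF _ one] by simp
    qed
  qed
  then show "\<theta> \<in> {0..1}" and "(a1 * \<theta> + b1) * (a2 * \<theta> + b2) \<le> c"
    using poly by auto
qed

section \<open>Energy stability of the relaxed scheme\<close>

theorem theorem2p2:
  fixes \<Omega> :: "'a::euclidean_space set"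
    and DL DG :: "('a \<Rightarrow> real) set"
    and L G :: "('a \<Rightarrow> real) \<Rightarrow> 'a \<Rightarrow> real"
    and F :: "nat \<Rightarrow> real \<Rightarrow> real"
    and \<delta>t \<gamma> :: real
    and N :: nat
    and \<phi> \<phi>s \<mu> :: "nat \<Rightarrow> 'a \<Rightarrow> real"
    and r rs rt a b :: "nat \<Rightarrow> nat \<Rightarrow> real"
    and c \<theta> R :: "nat \<Rightarrow> real"
  assumes ops: "gradient_flow_operators \<Omega> DL L DG G"
    and dt: "\<delta>t > 0"
    and gamma: "0 \<le> \<gamma>" "\<gamma> \<le> 1"
    and init: "\<forall>i\<in>{1, 2}. r i 0 > 0 \<and> r i 1 > 0"
    and step1: "\<forall>n\<in>{1..N}. step1 \<Omega> DL L DG G F \<delta>t \<phi> \<phi>s \<mu> r rs rt n"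
    and a: "\<forall>n\<in>{1..N}. \<forall>i\<in>{1, 2}. a i n = rt i (Suc n) - exp (energy \<Omega> (F i) (\<phi> (Suc n)))"
    and b: "\<forall>n\<in>{1..N}. \<forall>i\<in>{1, 2}. b i n = exp (energy \<Omega> (F i) (\<phi> (Suc n)))"
    and c: "\<forall>n\<in>{1..N}. c n =
              exp (\<delta>t * \<gamma> * l2_inner \<Omega> (G (\<mu> n)) (\<mu> n) + ln (rt 1 (Suc n)) + ln (rt 2 (Suc n)))"
    and theta: "\<forall>n\<in>{1..N}. theta_choice (a 1 n) (a 2 n) (b 1 n) (b 2 n) (c n) (\<theta> (Suc n))"
    and step2: "\<forall>n\<in>{1..N}. \<forall>i\<in>{1, 2}. r i (Suc n) =
                  \<theta> (Suc n) * rt i (Suc n)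
                  + (1 - \<theta> (Suc n)) * exp (energy \<Omega> (F i) (\<phi> (Suc n)))"
    and R: "\<And>n. R n = 1 / 2 * l2_inner \<Omega> (L (\<phi> n)) (\<phi> n) + ln (r 1 n) + ln (r 2 n)"
  shows "\<forall>n\<in>{1..N}.
           (a 1 n * \<theta> (Suc n) + b 1 n) * (a 2 n * \<theta> (Suc n) + b 2 n) \<le> c n \<and>
           \<theta> (Suc n) \<in> relaxation_set \<delta>t \<gamma> (l2_inner \<Omega> (G (\<mu> n)) (\<mu> n))
                         (\<lambda>i. rt i (Suc n)) (\<lambda>i. exp (energy \<Omega> (F i) (\<phi> (Suc n)))) \<and>
           r 1 (Suc n) > 0 \<and> r 2 (Suc n) > 0 \<and>
           R (Suc n) - R n \<le> - \<delta>t * (1 - \<gamma>) * l2_inner \<Omega> (G (\<mu> n)) (\<mu> n) \<and>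
           - \<delta>t * (1 - \<gamma>) * l2_inner \<Omega> (G (\<mu> n)) (\<mu> n) \<le> 0"
proof
  fix n assume n: "n \<in> {1..N}"
  define d where "d = l2_inner \<Omega> (G (\<mu> n)) (\<mu> n)"
  note step = bspec[OF step1 n]
  have rt: "rt 1 (Suc n) > 0" "rt 2 (Suc n) > 0" and \<mu>: "\<mu> n \<in> DG"
    using step by (simp_all add: step1_def del: One_nat_def)
  have d: "d \<ge> 0"
    using ops \<mu> by (simp add: d_def gradient_flow_operators_def positive_on_def)
  have ab: "a i n + b i n = rt i (Suc n)" "b i n > 0" if "i \<in> {1, 2}" for i
    using bspec[OF bspec[OF a n] that] bspec[OF bspec[OF b n] that] by simp_all
  have c': "c n = exp (\<delta>t * \<gamma> * d) * (rt 1 (Suc n) * rt 2 (Suc n))"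
    using c n rt by (simp add: d_def exp_add del: One_nat_def)
  \<comment> \<open>The exponential factor is at least 1 because the dissipation is nonnegative. As
    \<open>a i n + b i n\<close> is the unrelaxed variable, this is the required bound at 1.\<close>
  have "1 * (rt 1 (Suc n) * rt 2 (Suc n)) \<le> c n"
    unfolding c' using rt dt gamma d by (intro mult_right_mono) simp_all
  then have c_ge: "(a 1 n + b 1 n) * (a 2 n + b 2 n) \<le> c n"
    by (simp add: ab del: One_nat_def)
  have \<theta>: "\<theta> (Suc n) \<in> {0..1}"
    and quad: "(a 1 n * \<theta> (Suc n) + b 1 n) * (a 2 n * \<theta> (Suc n) + b 2 n) \<le> c n"
    using theta_choice_admissible[OF bspec[OF theta n] _ _ c_ge] ab rt by simp_all
  have r_eq: "r i (Suc n) = a i n * \<theta> (Suc n) + b i n"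
    and r_pos: "r i (Suc n) > 0" if i: "i \<in> {1, 2}" for i
  proof -
    note step2_i = bspec[OF bspec[OF step2 n] i, folded bspec[OF bspec[OF b n] i]]
    show "r i (Suc n) = a i n * \<theta> (Suc n) + b i n"
      unfolding step2_i ab(1)[OF i, symmetric] by (simp add: algebra_simps)
    \<comment> \<open>A convex combination of two positive numbers; the case
      \<open>\<theta> (Suc n) = 0\<close> is separate because there only the second summand is
      positive.\<close>
    have "rt i (Suc n) > 0"
      using i rt by auto
    then show "r i (Suc n) > 0"
      unfolding step2_i using \<theta> ab(2)[OF i]
      by (cases "\<theta> (Suc n) = 0") (auto intro!: add_pos_nonneg)
  qed
  have r: "r 1 (Suc n) > 0" "r 2 (Suc n) > 0"
    by (simp_all add: r_pos del: One_nat_def)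
  \<comment> \<open>By \<open>r_eq\<close> the quadratic bound reads r1 r2 \<le> c; positivity then
    lets the logarithm turn it into the inequality defining the relaxation set.\<close>
  have "ln (r 1 (Suc n) * r 2 (Suc n)) \<le> ln (c n)"
    using quad r by (intro ln_mono) (simp_all add: r_eq del: One_nat_def)
  then have relax: "ln (r 1 (Suc n)) + ln (r 2 (Suc n)) - ln (rt 1 (Suc n)) - ln (rt 2 (Suc n))
      \<le> \<delta>t * \<gamma> * d"
    using r rt by (simp add: c' ln_mult del: One_nat_def)
  have W: "\<theta> (Suc n) \<in> relaxation_set \<delta>t \<gamma> d
             (\<lambda>i. rt i (Suc n)) (\<lambda>i. exp (energy \<Omega> (F i) (\<phi> (Suc n))))"
    using relax \<theta> step2 n by (simp add: relaxation_set_def del: One_nat_def)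
  \<comment> \<open>Adding \<open>relax\<close> to the energy law cancels the unrelaxed
    logarithms.\<close>
  have "R (Suc n) - R n \<le> - \<delta>t * d + \<delta>t * \<gamma> * d"
    using step1_energy_law[OF ops dt step] relax unfolding R d_def by linarith
  then have "R (Suc n) - R n \<le> - \<delta>t * (1 - \<gamma>) * d"
    by (simp add: algebra_simps)
  moreover have "- \<delta>t * (1 - \<gamma>) * d \<le> 0"
    using dt gamma d by simp
  ultimately show "(a 1 n * \<theta> (Suc n) + b 1 n) * (a 2 n * \<theta> (Suc n) + b 2 n) \<le> c n \<and>
      \<theta> (Suc n) \<in> relaxation_set \<delta>t \<gamma> (l2_inner \<Omega> (G (\<mu> n)) (\<mu> n))
                    (\<lambda>i. rt i (Suc n)) (\<lambda>i. exp (energy \<Omega> (F i) (\<phi> (Suc n)))) \<and>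
      r 1 (Suc n) > 0 \<and> r 2 (Suc n) > 0 \<and>
      R (Suc n) - R n \<le> - \<delta>t * (1 - \<gamma>) * l2_inner \<Omega> (G (\<mu> n)) (\<mu> n) \<and>
      - \<delta>t * (1 - \<gamma>) * l2_inner \<Omega> (G (\<mu> n)) (\<mu> n) \<le> 0"
    using quad W r unfolding d_def by blast
qed

end
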